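(* Let $\mathcal{H}$ be a complex Hilbert space and let $A\in\mathcal{B}(\mathcal{H})$. Then for any $1\le r\le 2$, \[\frac{1}{4^{r}}\left\| |A|+|A^{*}| \right\|^{r}\le \left\| \int_{0}^{1}\left( \frac{(1-t)|A|+t|A^{*}|}{2} \right)^{r}dt \right\|\le \frac{1}{2^{r}}\|A\|^{r}.\] In particular, \[\frac{1}{4}\left\| |A|+|A^{*}| \right\|\le \left\| \int_{0}^{1}\left( \frac{(1-t)|A|+t|A^{*}|}{2} \right)^{2}dt \right\|^{\frac{1}{2}}\le \frac{1}{2}\|A\|.\]
   Context: $\mathcal{B}(\mathcal{H})$ is the $C^*$-algebra of bounded linear operators on the complex Hilbert space $\mathcal{H}$; $\|\cdot\|$ is the operator norm; $|A|=(A^*A)^{1/2}$ and $|A^*|=(AA^* )^{1/2}$. Powers of positive semi-definite operators are defined by functional calculus. *)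

theory Defs
  imports "HOL-Analysis.Analysis" "HOL-Computational_Algebra.Polynomial"
begin

text \<open>Complex Hilbert spaces, layered over the real normed spaces of the library so that
  bounded operators can use \<open>'a \<Rightarrow>\<^sub>L 'a\<close>. The inner product is linear in its first argument.\<close>

class complex_inner_space = real_normed_vector +
  fixes scaleC :: "complex \<Rightarrow> 'a \<Rightarrow> 'a"
    and cinner :: "'a \<Rightarrow> 'a \<Rightarrow> complex"
  assumes scaleC_add_right: "scaleC c (x + y) = scaleC c x + scaleC c y"
    and scaleC_add_left: "scaleC (c + d) x = scaleC c x + scaleC d x"
    and scaleC_scaleC: "scaleC c (scaleC d x) = scaleC (c * d) x"
    and scaleC_of_real: "scaleC (complex_of_real s) x = scaleR s x"
    and cinner_commute: "cinner x y = cnj (cinner y x)"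
    and cinner_add_left: "cinner (x + y) z = cinner x z + cinner y z"
    and cinner_scaleC_left: "cinner (scaleC c x) y = c * cinner x y"
    and cinner_self_nonneg: "0 \<le> Re (cinner x x)"
    and cinner_self_eq_0_iff: "cinner x x = 0 \<longleftrightarrow> x = 0"
    and norm_eq_sqrt_cinner: "norm x = sqrt (Re (cinner x x))"

class complex_hilbert_space = complex_inner_space + banach

instantiation complex :: complex_hilbert_space
begin

definition scaleC_complex :: "complex \<Rightarrow> complex \<Rightarrow> complex"
  where "scaleC_complex c x = c * x"

definition cinner_complex :: "complex \<Rightarrow> complex \<Rightarrow> complex"
  where "cinner_complex x y = x * cnj y"

instance
proof
  fix x :: complex
  show "norm x = sqrt (Re (cinner x x))"
    by (simp add: cinner_complex_def complex_norm_square[symmetric] cmod_def power2_eq_square)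
qed (auto simp: scaleC_complex_def cinner_complex_def algebra_simps scaleR_conv_of_real)

end

text \<open>\<open>'a \<Rightarrow>\<^sub>L 'a\<close> consists of the bounded real-linear maps, normed by the operator norm;
  \<open>\<B>(\<H>)\<close> is its closed real subspace of complex-linear maps.\<close>

definition bounded_ops :: "('a::complex_hilbert_space \<Rightarrow>\<^sub>L 'a) set"
  where "bounded_ops = {A. \<forall>c x. blinfun_apply A (scaleC c x) = scaleC c (blinfun_apply A x)}"

definition adjoint_op ::
    "('a::complex_hilbert_space \<Rightarrow>\<^sub>L 'a) \<Rightarrow> ('a \<Rightarrow>\<^sub>L 'a)"
  where "adjoint_op A = (THE B. B \<in> bounded_ops \<and>
    (\<forall>x y. cinner (blinfun_apply A x) y = cinner x (blinfun_apply B y)))"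

text \<open>The two equations below say that \<open>S\<close> is a two-sided inverse of \<open>T - \<lambda> I\<close>.\<close>

definition op_spectrum :: "('a::complex_hilbert_space \<Rightarrow>\<^sub>L 'a) \<Rightarrow> complex set"
  where "op_spectrum T = {l. \<not> (\<exists>S\<in>bounded_ops. \<forall>x.
    blinfun_apply S (blinfun_apply T x - scaleC l x) = x \<and>
    blinfun_apply T (blinfun_apply S x) - scaleC l (blinfun_apply S x) = x)}"

definition poly_op ::
    "real poly \<Rightarrow> ('a::complex_hilbert_space \<Rightarrow>\<^sub>L 'a) \<Rightarrow> ('a \<Rightarrow>\<^sub>L 'a)"
  where "poly_op p T =
    (\<Sum>i\<le>degree p. coeff p i *\<^sub>R ((\<lambda>B. T o\<^sub>L B) ^^ i) id_blinfun)"

text \<open>Continuous functional calculus for a self-adjoint \<open>T\<close> and a real function \<open>f\<close> continuous on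
  the spectrum (which is then real): \<open>f(T)\<close> is the norm limit of \<open>p\<^sub>n(T)\<close> for polynomials \<open>p\<^sub>n\<close>
  converging to \<open>f\<close> uniformly on the spectrum.\<close>

definition op_fun_calc ::
    "(real \<Rightarrow> real) \<Rightarrow> ('a::complex_hilbert_space \<Rightarrow>\<^sub>L 'a) \<Rightarrow> ('a \<Rightarrow>\<^sub>L 'a)"
  where "op_fun_calc f T = (THE S. \<exists>p :: nat \<Rightarrow> real poly.
    uniform_limit {x. complex_of_real x \<in> op_spectrum T} (\<lambda>n x. poly (p n) x) f sequentially \<and>
    (\<lambda>n. poly_op (p n) T) \<longlonglongrightarrow> S)"

text \<open>Meant for positive semi-definite \<open>T\<close> and \<open>r > 0\<close>, where \<open>0 powr r = 0\<close> is the right value.\<close>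

definition op_powr ::
    "('a::complex_hilbert_space \<Rightarrow>\<^sub>L 'a) \<Rightarrow> real \<Rightarrow> ('a \<Rightarrow>\<^sub>L 'a)"
  where "op_powr T r = op_fun_calc (\<lambda>x. x powr r) T"

definition abs_op ::
    "('a::complex_hilbert_space \<Rightarrow>\<^sub>L 'a) \<Rightarrow> ('a \<Rightarrow>\<^sub>L 'a)"
  where "abs_op A = op_powr (adjoint_op A o\<^sub>L A) (1/2)"

end

theory Submission
  imports Defs "HOL-Computational_Algebra.Fundamental_Theorem_Algebra"
begin

text \<open>
  Let \<open>P\<close> and \<open>Q\<close> be the absolute values of \<open>A\<close> and of its adjoint, and
  \<open>B\<^sub>t = ((1 - t) P + t Q) / 2\<close>, a positive operator. The upper bound is immediate: both absolute
  values have norm at most \<open>\<parallel>A\<parallel>\<close>, so \<open>\<parallel>B\<^sub>t\<parallel> \<le> \<parallel>A\<parallel> / 2\<close> and \<open>\<parallel>B\<^sub>t\<^sup>r\<parallel> \<le> (\<parallel>A\<parallel> / 2)\<^sup>r\<close>, and the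
  norm of the integral is at most the supremum of the norms
  (\<open>norm_integral_op_powr_half_segment_le\<close>).

  For the lower bound operator convexity can be avoided; convexity of the scalar function
  \<open>s \<mapsto> s\<^sup>r\<close> is enough. The mean of \<open>B\<^sub>t\<close> over \<open>t\<close> is \<open>(P + Q) / 4\<close>. For a unit vector \<open>x\<close> let \<open>c\<close> be
  the value \<open>\<langle>(P + Q) x, x\<rangle> / 4\<close>. The graph of \<open>s\<^sup>r\<close> lies above its tangent at \<open>c > 0\<close>, so by the
  functional calculus \<open>\<langle>B\<^sub>t\<^sup>r x, x\<rangle> \<ge> c\<^sup>r + r c\<^sup>r\<^sup>-\<^sup>1 (\<langle>B\<^sub>t x, x\<rangle> - c)\<close>. Integration over \<open>t\<close> removes the
  linear term and leaves \<open>c\<^sup>r\<close> as a lower bound for the norm of the integral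
  (\<open>integral_op_powr_half_segment_ge\<close>). Since the values \<open>\<langle>(P + Q) x, x\<rangle>\<close> at unit vectors
  determine the norm of the positive operator \<open>P + Q\<close> (\<open>norm_positive_op_le\<close>), the claim follows.
  The integral exists because \<open>B\<^sub>t\<^sup>r\<close> depends continuously on \<open>t\<close>.

  Most of the work goes into the functional calculus itself. Its foundation is \<open>norm_poly_op_le\<close>:
  for a symmetric \<open>T\<close>, a bound for a real polynomial \<open>p\<close> on the spectrum bounds \<open>\<parallel>p(T)\<parallel>\<close>. This is
  proved without the spectral radius formula: the operator \<open>p(T)\<^sup>2 - \<parallel>p(T)\<parallel>\<^sup>2\<close> on a nonzero
  space is never bounded below, while a nonzero real polynomial without zeros on the spectrum factors into polynomials whose
  values at \<open>T\<close> are bounded below. With Weierstrass approximation, uniform closeness to a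
  polynomial on \<open>{0..K}\<close> passes to all positive operators of norm at most \<open>K\<close>
  (\<open>op_fun_calc_close_poly_op\<close>), which gives the norm, order and continuity properties used above.
\<close>

section \<open>The real inner product of a complex Hilbert space\<close>

text \<open>The real part of the inner product is a genuine real inner product. Arguments that never use the
  complex structure are carried out with it, as the operators are given as real-linear maps.\<close>

definition rinner :: "'a::complex_inner_space \<Rightarrow> 'a \<Rightarrow> real"
  where "rinner x y = Re (cinner x y)"

lemma rinner_commute: "rinner x y = rinner y x"
  unfolding rinner_def by (subst cinner_commute) simp

lemma rinner_self: "rinner x x = (norm x)\<^sup>2"
  by (simp add: rinner_def norm_eq_sqrt_cinner cinner_self_nonneg)

lemma rinner_add_left: "rinner (x + y) z = rinner x z + rinner y z"
  by (simp add: rinner_def cinner_add_left)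

lemma rinner_scaleR_left: "rinner (s *\<^sub>R x) y = s * rinner x y"
  by (simp add: rinner_def scaleC_of_real[symmetric] cinner_scaleC_left)

lemma rinner_add_right: "rinner z (x + y) = rinner z x + rinner z y"
  by (metis rinner_commute rinner_add_left)

lemma rinner_scaleR_right: "rinner y (s *\<^sub>R x) = s * rinner y x"
  by (metis rinner_commute rinner_scaleR_left)

lemma rinner_diff_left: "rinner (x - y) z = rinner x z - rinner y z"
  by (metis add_diff_cancel diff_add_cancel rinner_add_left)

lemma rinner_diff_right: "rinner z (x - y) = rinner z x - rinner z y"
  by (metis rinner_commute rinner_diff_left)

lemma norm_add_scaleR_squared:
  "(norm (x + s *\<^sub>R y))\<^sup>2 = (norm x)\<^sup>2 + 2 * s * rinner x y + s\<^sup>2 * (norm y)\<^sup>2"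
  unfolding rinner_self[symmetric]
  by (simp add: rinner_add_left rinner_add_right rinner_scaleR_left rinner_scaleR_right
      rinner_commute[of y x] power2_eq_square algebra_simps)

lemma rinner_le_norm: "\<bar>rinner x y\<bar> \<le> norm x * norm y"
proof (cases "y = 0")
  case True
  then show ?thesis using rinner_scaleR_right[of x 0 0] by simp
next
  case False
  define s where "s = - rinner x y / (norm y)\<^sup>2"
  have "0 \<le> (norm x)\<^sup>2 + 2 * s * rinner x y + s\<^sup>2 * (norm y)\<^sup>2"
    using norm_add_scaleR_squared[of x s y] by (metis zero_le_power2)
  then have "(rinner x y)\<^sup>2 \<le> (norm x)\<^sup>2 * (norm y)\<^sup>2"
    using False by (simp add: s_def power2_eq_square field_simps)
  then show ?thesis
    by (metis abs_le_square_iff abs_mult abs_norm_cancel power_mult_distrib)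
qed

lemma bounded_bilinear_rinner: "bounded_bilinear (rinner :: 'a::complex_inner_space \<Rightarrow> 'a \<Rightarrow> real)"
  by standard (auto simp: rinner_add_left rinner_add_right rinner_scaleR_left rinner_scaleR_right
      intro!: exI[of _ 1] rinner_le_norm)

interpretation rinner: bounded_bilinear "rinner :: 'a::complex_inner_space \<Rightarrow> 'a \<Rightarrow> real"
  by (rule bounded_bilinear_rinner)

lemma eq_if_rinner_eq:
  assumes "\<And>x. rinner x y = rinner x z"
  shows "y = z"
proof -
  have "rinner (y - z) (y - z) = 0" by (simp add: rinner_diff_right assms)
  then show ?thesis by (simp add: rinner_self)
qed

lemma cinner_scaleC_right: "cinner x (scaleC c y) = cnj c * cinner x y"
  by (metis cinner_commute cinner_scaleC_left complex_cnj_mult)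

lemma Im_cinner: "Im (cinner x y) = rinner (scaleC (- \<i>) x) y"
  by (simp add: rinner_def cinner_scaleC_left)

lemma parallelogram_identity:
  fixes x y :: "'a::complex_inner_space"
  shows "(norm (x + y))\<^sup>2 + (norm (x - y))\<^sup>2 = 2 * (norm x)\<^sup>2 + 2 * (norm y)\<^sup>2"
  using norm_add_scaleR_squared[of x 1 y] norm_add_scaleR_squared[of x "-1" y] by simp


text \<open>By the parallelogram law the points of \<open>C\<close> that are almost closest to \<open>y\<close> form sets whose
  diameters shrink to zero, so by completeness there is a closest point; moving it along a
  direction \<open>w\<close> of \<open>C\<close> cannot bring it closer, which is orthogonality.\<close>

lemma orthogonal_projection_exists:
  fixes C :: "'a::complex_hilbert_space set"
  assumes "subspace C" "closed C"
  obtains z where "z \<in> C" "\<And>w. w \<in> C \<Longrightarrow> rinner (y - z) w = 0"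
proof -
  define d where "d = (INF w\<in>C. (norm (y - w))\<^sup>2)"
  have ne: "C \<noteq> {}" using subspace_0[OF assms(1)] by auto
  have bdd: "bdd_below ((\<lambda>w. (norm (y - w))\<^sup>2) ` C)" by (rule bdd_belowI[of _ 0]) auto
  have d_le: "d \<le> (norm (y - w))\<^sup>2" if "w \<in> C" for w
    unfolding d_def using bdd that by (rule cINF_lower)
  define S where "S n = {w \<in> C. (norm (y - w))\<^sup>2 \<le> d + inverse (Suc n)}" for n
  have diam: "(dist u v)\<^sup>2 \<le> 4 * inverse (Suc n)" if "u \<in> S n" "v \<in> S n" for u v n
  proof -
    have C: "u \<in> C" "v \<in> C" using that by (auto simp: S_def)
    then have "(1/2) *\<^sub>R (u + v) \<in> C"
      using assms(1) by (intro subspace_mul subspace_add)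
    from d_le[OF this] have "4 * d \<le> (2 * norm (y - (1/2) *\<^sub>R (u + v)))\<^sup>2"
      by (simp add: power_mult_distrib)
    also have "2 * norm (y - (1/2) *\<^sub>R (u + v)) = norm (2 *\<^sub>R (y - (1/2) *\<^sub>R (u + v)))" by simp
    also have "2 *\<^sub>R (y - (1/2) *\<^sub>R (u + v)) = (y - u) + (y - v)"
      by (simp add: algebra_simps scaleR_2)
    finally have "4 * d \<le> (norm ((y - u) + (y - v)))\<^sup>2" .
    moreover have "dist u v = norm ((y - u) - (y - v))" by (simp add: dist_norm norm_minus_commute)
    then have "(dist u v)\<^sup>2 = (norm ((y - u) - (y - v)))\<^sup>2" by simp
    moreover have "(norm (y - u))\<^sup>2 \<le> d + inverse (Suc n)" "(norm (y - v))\<^sup>2 \<le> d + inverse (Suc n)"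
      using that by (auto simp: S_def)
    ultimately show ?thesis using parallelogram_identity[of "y - u" "y - v"] by linarith
  qed
  obtain z where z: "\<And>n. z \<in> S n"
  proof (rule decreasing_closed_nest[of S])
    show "closed (S n)" for n
    proof -
      have "S n = C \<inter> {w. (norm (y - w))\<^sup>2 \<le> d + inverse (Suc n)}" by (auto simp: S_def)
      then show ?thesis using assms(2)
        by (auto intro!: closed_Int closed_Collect_le continuous_intros)
    qed
    show "S n \<noteq> {}" for n
      using cINF_less_iff[OF ne bdd, of "d + inverse (Suc n)"]
      by (fastforce simp: S_def d_def[symmetric])
    show "S n \<subseteq> S m" if "m \<le> n" for m n
    proof -
      have "inverse (real (Suc n)) \<le> inverse (real (Suc m))" using that by (intro le_imp_inverse_le) auto
      then have "(norm (y - w))\<^sup>2 \<le> d + inverse (Suc m)" if "w \<in> S n" for w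
        using that unfolding S_def mem_Collect_eq by linarith
      moreover have "S n \<subseteq> C" by (auto simp: S_def)
      ultimately show ?thesis unfolding S_def[of m] by blast
    qed
    show "\<exists>n. \<forall>x\<in>S n. \<forall>y\<in>S n. dist x y < e" if "e > 0" for e
    proof -
      have "e\<^sup>2 / 4 > 0" using that by simp
      then obtain n where n: "inverse (real (Suc n)) < e\<^sup>2 / 4" using reals_Archimedean by blast
      have "dist u v < e" if "u \<in> S n" "v \<in> S n" for u v
        using diam[OF that] n \<open>e > 0\<close> by (intro power2_less_imp_less[of _ e]) auto
      then show ?thesis by blast
    qed
  qed blast
  have "z \<in> C" using z by (auto simp: S_def)
  have "(norm (y - z))\<^sup>2 \<le> d"
  proof (rule field_le_epsilon)
    fix e :: real assume "e > 0"
    then obtain n where "inverse (real (Suc n)) < e" using reals_Archimedean by blast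
    then show "(norm (y - z))\<^sup>2 \<le> d + e" using z[of n] by (auto simp: S_def)
  qed
  have "rinner (y - z) w = 0" if "w \<in> C" for w
  proof (cases "w = 0")
    case False
    \<comment> \<open>the step length that minimizes the distance along \<open>w\<close>\<close>
    define s where "s = - rinner (y - z) w / (norm w)\<^sup>2"
    have "z - s *\<^sub>R w \<in> C" using \<open>z \<in> C\<close> that assms(1) by (intro subspace_diff subspace_mul)
    moreover have "y - (z - s *\<^sub>R w) = (y - z) + s *\<^sub>R w" by simp
    ultimately have "(norm (y - z))\<^sup>2 \<le> (norm ((y - z) + s *\<^sub>R w))\<^sup>2"
      using d_le \<open>(norm (y - z))\<^sup>2 \<le> d\<close> by (metis order_trans)
    then have "0 \<le> 2 * s * rinner (y - z) w + s\<^sup>2 * (norm w)\<^sup>2"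
      by (simp add: norm_add_scaleR_squared)
    then have "(rinner (y - z) w)\<^sup>2 \<le> 0"
      using False by (simp add: s_def power2_eq_square field_simps)
    then show ?thesis by simp
  qed (simp add: rinner.zero_right)
  with \<open>z \<in> C\<close> show thesis by (rule that)
qed


text \<open>The representing vector is a multiple of a vector orthogonal to the kernel: the kernel has
  codimension one, so such a vector determines the functional up to scale.\<close>

lemma Riesz_representation:
  fixes f :: "'a::complex_hilbert_space \<Rightarrow> real"
  assumes "bounded_linear f"
  obtains z where "\<And>x. f x = rinner x z"
proof (cases "\<forall>x. f x = 0")
  case True
  then show thesis using that[of 0] by (simp add: rinner.zero_right)
next
  case False
  interpret f: bounded_linear f by fact
  obtain y where y: "f y \<noteq> 0" using False by blast
  have "subspace {x. f x = 0}" by (auto simp: subspace_def f.add f.scaleR f.zero)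
  moreover have "closed {x. f x = 0}"
    by (intro closed_Collect_eq continuous_intros f.continuous_on)
  ultimately obtain z where z: "f z = 0" "\<And>w. f w = 0 \<Longrightarrow> rinner (y - z) w = 0"
    using orthogonal_projection_exists[of "{x. f x = 0}" y] by auto
  define n where "n = y - z"
  have fn: "f n = f y" by (simp add: n_def f.diff z)
  have n0: "n \<noteq> 0" using fn y f.zero by auto
  have "f x = rinner x ((f n / (norm n)\<^sup>2) *\<^sub>R n)" for x
  proof -
    have "f (x - (f x / f n) *\<^sub>R n) = 0" using y fn by (simp add: f.diff f.scaleR)
    then have "rinner n (x - (f x / f n) *\<^sub>R n) = 0" using z(2) unfolding n_def by blast
    then have "rinner x n = f x / f n * (norm n)\<^sup>2"
      by (simp add: rinner_diff_right rinner_scaleR_right rinner_self rinner_commute[of n x])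
    then show ?thesis using n0 y fn by (simp add: rinner_scaleR_right)
  qed
  then show thesis by (rule that)
qed

section \<open>Adjoint, symmetric and positive operators\<close>

text \<open>Only the real part of the inner product is tested; for a complex-linear \<open>T\<close> this already means
  that \<open>T\<close> is self-adjoint, since \<open>x\<close> may be replaced by a complex multiple.\<close>

definition symmetric_op :: "('a::complex_inner_space \<Rightarrow>\<^sub>L 'a) \<Rightarrow> bool"
  where "symmetric_op T \<longleftrightarrow> (\<forall>x y. rinner (T x) y = rinner x (T y))"

definition positive_op :: "('a::complex_hilbert_space \<Rightarrow>\<^sub>L 'a) \<Rightarrow> bool"
  where "positive_op T \<longleftrightarrow> T \<in> bounded_ops \<and> symmetric_op T \<and> (\<forall>x. 0 \<le> rinner (T x) x)"

lemma symmetric_opD: "symmetric_op T \<Longrightarrow> rinner (T x) y = rinner x (T y)"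
  by (simp add: symmetric_op_def)

lemma bounded_opsD: "T \<in> bounded_ops \<Longrightarrow> T (scaleC c x) = scaleC c (T x)"
  by (simp add: bounded_ops_def)

lemma scaleC_zero_right: "scaleC c 0 = (0 :: 'a::complex_inner_space)"
  using scaleC_add_right[of c 0 "0::'a"] by simp

lemma scaleC_scaleR: "scaleC c (s *\<^sub>R x) = s *\<^sub>R scaleC c x"
  by (metis scaleC_of_real scaleC_scaleC mult.commute)

lemma norm_scaleC: "norm (scaleC c x) = norm c * norm x"
proof -
  have "cinner (scaleC c x) (scaleC c x) = of_real ((cmod c)\<^sup>2) * cinner x x"
    unfolding complex_norm_square by (simp add: cinner_scaleC_left cinner_scaleC_right)
  then have "Re (cinner (scaleC c x) (scaleC c x)) = (cmod c)\<^sup>2 * Re (cinner x x)"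
    by simp
  then show ?thesis by (simp add: norm_eq_sqrt_cinner[of x] norm_eq_sqrt_cinner[of "scaleC c x"] real_sqrt_mult)
qed

lemma scaleC_minus_right: "scaleC c (- x) = - scaleC c x"
  using scaleC_scaleR[of c "-1" x] by simp

lemma scaleC_diff_right: "scaleC c (x - y) = scaleC c x - scaleC c y"
  using scaleC_add_right[of c x "- y"] by (simp add: scaleC_minus_right)

lemma bounded_linear_scaleC: "bounded_linear (scaleC c :: 'a::complex_inner_space \<Rightarrow> 'a)"
  by (rule bounded_linear_intro[of _ "norm c"])
    (auto simp: scaleC_add_right scaleC_scaleR norm_scaleC)

lemma bounded_ops_add: "S \<in> bounded_ops \<Longrightarrow> T \<in> bounded_ops \<Longrightarrow> S + T \<in> bounded_ops"
  by (simp add: bounded_ops_def blinfun.add_left scaleC_add_right)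

lemma bounded_ops_scaleR: "T \<in> bounded_ops \<Longrightarrow> s *\<^sub>R T \<in> bounded_ops"
  by (simp add: bounded_ops_def blinfun.scaleR_left scaleC_scaleR)

lemma bounded_ops_compose: "S \<in> bounded_ops \<Longrightarrow> T \<in> bounded_ops \<Longrightarrow> S o\<^sub>L T \<in> bounded_ops"
  by (simp add: bounded_ops_def)

lemma bounded_ops_id: "id_blinfun \<in> bounded_ops"
  by (simp add: bounded_ops_def)

lemma bounded_ops_0: "0 \<in> bounded_ops"
  by (simp add: bounded_ops_def scaleC_zero_right)

lemma bounded_ops_limit:
  assumes "\<And>n. S n \<in> bounded_ops" "S \<longlonglongrightarrow> T"
  shows "T \<in> bounded_ops"
proof -
  have "T (scaleC c x) = scaleC c (T x)" for c x
  proof (rule LIMSEQ_unique)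
    show "(\<lambda>n. S n (scaleC c x)) \<longlonglongrightarrow> T (scaleC c x)"
      by (intro tendsto_intros assms)
    have "(\<lambda>n. scaleC c (S n x)) \<longlonglongrightarrow> scaleC c (T x)"
      by (intro bounded_linear.tendsto[OF bounded_linear_scaleC] tendsto_intros assms)
    then show "(\<lambda>n. S n (scaleC c x)) \<longlonglongrightarrow> scaleC c (T x)"
      by (simp add: bounded_opsD[OF assms(1)])
  qed
  then show ?thesis by (simp add: bounded_ops_def)
qed

lemma symmetric_op_limit:
  assumes "\<And>n. symmetric_op (S n)" "S \<longlonglongrightarrow> T"
  shows "symmetric_op T"
proof -
  have "rinner (T x) y = rinner x (T y)" for x y
  proof (rule LIMSEQ_unique)
    show "(\<lambda>n. rinner (S n x) y) \<longlonglongrightarrow> rinner (T x) y"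
      by (intro rinner.tendsto tendsto_intros assms)
    have "(\<lambda>n. rinner x (S n y)) \<longlonglongrightarrow> rinner x (T y)"
      by (intro rinner.tendsto tendsto_intros assms)
    then show "(\<lambda>n. rinner (S n x) y) \<longlonglongrightarrow> rinner x (T y)"
      by (simp add: symmetric_opD[OF assms(1)])
  qed
  then show ?thesis by (simp add: symmetric_op_def)
qed

lemma positive_op_add: "positive_op S \<Longrightarrow> positive_op T \<Longrightarrow> positive_op (S + T)"
  by (auto simp: positive_op_def symmetric_op_def bounded_ops_add blinfun.add_left
      rinner_add_left rinner_add_right)

lemma positive_op_scaleR: "positive_op T \<Longrightarrow> 0 \<le> s \<Longrightarrow> positive_op (s *\<^sub>R T)"
  by (auto simp: positive_op_def symmetric_op_def bounded_ops_scaleR blinfun.scaleR_left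
      rinner_scaleR_left rinner_scaleR_right)


text \<open>The Riesz representation of the real part of \<open>\<lambda>x. cinner (A x) y\<close> suffices, since complex
  linearity recovers the imaginary part.\<close>

lemma adjoint_op_exists:
  fixes A :: "'a::complex_hilbert_space \<Rightarrow>\<^sub>L 'a"
  assumes "A \<in> bounded_ops"
  obtains B where "B \<in> bounded_ops" "\<And>x y. cinner (A x) y = cinner x (B y)"
proof -
  have "\<exists>z. \<forall>x. rinner (A x) y = rinner x z" for y
  proof -
    have "bounded_linear (\<lambda>x. rinner (A x) y)"
      by (rule bounded_linear_compose[OF rinner.bounded_linear_left blinfun.bounded_linear_right])
    from Riesz_representation[OF this] show ?thesis by metis
  qed
  then obtain b where b: "\<And>x y. rinner (A x) y = rinner x (b y)" by metis
  have cb: "cinner (A x) y = cinner x (b y)" for x y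
    by (rule complex_eqI)
      (simp_all only: Im_cinner b[symmetric] bounded_opsD[OF assms, symmetric],
        simp add: b rinner_def[symmetric])
  have "bounded_linear b"
  proof (rule bounded_linear_intro[of _ "norm A"])
    show "b (x + y) = b x + b y" for x y
      by (rule eq_if_rinner_eq) (simp add: b[symmetric] rinner_add_right)
    show "b (s *\<^sub>R x) = s *\<^sub>R b x" for s x
      by (rule eq_if_rinner_eq) (simp add: b[symmetric] rinner_scaleR_right)
    show "norm (b y) \<le> norm y * norm A" for y
    proof (cases "b y = 0")
      case False
      have "norm (b y) * norm (b y) = rinner (A (b y)) y" by (simp add: b rinner_self power2_eq_square)
      also have "\<dots> \<le> norm (A (b y)) * norm y" using rinner_le_norm[of "A (b y)" y] by simp
      also have "\<dots> \<le> norm A * norm (b y) * norm y" by (intro mult_right_mono norm_blinfun) auto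
      finally show ?thesis using False by (simp add: mult_ac)
    qed simp
  qed
  then have B: "blinfun_apply (Blinfun b) = b" by (rule bounded_linear_Blinfun_apply)
  have "b (scaleC c y) = scaleC c (b y)" for c y
    by (rule eq_if_rinner_eq)
      (simp add: rinner_def cb[symmetric] cinner_scaleC_right)
  then have "Blinfun b \<in> bounded_ops" by (simp add: bounded_ops_def B)
  then show thesis using cb by (intro that[of "Blinfun b"]) (auto simp: B)
qed

lemma adjoint_op:
  fixes A :: "'a::complex_hilbert_space \<Rightarrow>\<^sub>L 'a"
  assumes "A \<in> bounded_ops"
  shows "adjoint_op A \<in> bounded_ops" "rinner (A x) y = rinner x (adjoint_op A y)"
proof -
  obtain B where B: "B \<in> bounded_ops" "\<And>x y. cinner (A x) y = cinner x (B y)"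
    using adjoint_op_exists[OF assms] by metis
  have "adjoint_op A = B" unfolding adjoint_op_def
  proof (rule the_equality)
    show "C = B" if "C \<in> bounded_ops \<and> (\<forall>x y. cinner (A x) y = cinner x (C y))" for C
      by (rule blinfun_eqI, rule eq_if_rinner_eq) (metis rinner_def that B(2))
  qed (use B in blast)
  with B show "adjoint_op A \<in> bounded_ops" "rinner (A x) y = rinner x (adjoint_op A y)"
    by (auto simp: rinner_def)
qed

lemma norm_adjoint_op_le:
  assumes "A \<in> bounded_ops"
  shows "norm (adjoint_op A) \<le> norm A"
proof (rule norm_blinfun_bound)
  fix y
  show "norm (adjoint_op A y) \<le> norm A * norm y"
  proof (cases "adjoint_op A y = 0")
    case False
    let ?b = "adjoint_op A y"
    have "norm ?b * norm ?b = rinner (A ?b) y"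
      by (simp add: adjoint_op(2)[OF assms] rinner_self power2_eq_square)
    also have "\<dots> \<le> norm (A ?b) * norm y" using rinner_le_norm[of "A ?b" y] by simp
    also have "\<dots> \<le> norm A * norm ?b * norm y" by (intro mult_right_mono norm_blinfun) auto
    finally show ?thesis using False by (simp add: mult_ac)
  qed simp
qed simp

lemma positive_op_adjoint_compose:
  assumes "A \<in> bounded_ops"
  shows "positive_op (adjoint_op A o\<^sub>L A)"
proof -
  have *: "rinner (adjoint_op A (A x)) y = rinner (A x) (A y)" for x y
    by (metis adjoint_op(2)[OF assms] rinner_commute)
  then have "rinner x (adjoint_op A (A y)) = rinner (A x) (A y)" for x y
    by (metis rinner_commute)
  with * show ?thesis
    by (auto simp: positive_op_def symmetric_op_def adjoint_op(1) assms bounded_ops_compose rinner_self)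
qed

section \<open>Polynomials in an operator\<close>

text \<open>With a common summation limit, polynomials of different degrees are added termwise.\<close>

lemma poly_op_altdef:
  assumes "degree p \<le> n"
  shows "poly_op p T = (\<Sum>i\<le>n. coeff p i *\<^sub>R ((\<lambda>B. T o\<^sub>L B) ^^ i) id_blinfun)"
  unfolding poly_op_def
  by (rule sum.mono_neutral_left) (use assms in \<open>auto simp: coeff_eq_0\<close>)

lemma poly_op_0 [simp]: "poly_op 0 T = 0"
  by (simp add: poly_op_def)

lemma poly_op_pCons: "poly_op (pCons a p) T = a *\<^sub>R id_blinfun + (T o\<^sub>L poly_op p T)"
proof -
  have "poly_op (pCons a p) T
      = (\<Sum>i\<le>Suc (degree p). coeff (pCons a p) i *\<^sub>R ((\<lambda>B. T o\<^sub>L B) ^^ i) id_blinfun)"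
    by (rule poly_op_altdef) (simp add: degree_pCons_le)
  also have "\<dots> = a *\<^sub>R id_blinfun
      + (\<Sum>i\<le>degree p. T o\<^sub>L (coeff p i *\<^sub>R ((\<lambda>B. T o\<^sub>L B) ^^ i) id_blinfun))"
    by (subst sum.atMost_Suc_shift)
      (simp add: bounded_bilinear.scaleR_right[OF bounded_bilinear_blinfun_compose])
  also have "\<dots> = a *\<^sub>R id_blinfun + (T o\<^sub>L poly_op p T)"
    by (simp add: poly_op_def bounded_bilinear.sum_right[OF bounded_bilinear_blinfun_compose])
  finally show ?thesis .
qed

lemma poly_op_pCons_apply [simp]: "poly_op (pCons a p) T x = a *\<^sub>R x + T (poly_op p T x)"
  by (simp add: poly_op_pCons blinfun.bilinear_simps)

lemma poly_op_add: "poly_op (p + q) T = poly_op p T + poly_op q T"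
proof -
  define n where "n = max (degree p) (degree q)"
  have "degree (p + q) \<le> n" "degree p \<le> n" "degree q \<le> n"
    by (auto simp: n_def degree_add_le_max)
  then show ?thesis
    by (simp add: poly_op_altdef[where n = n] scaleR_left_distrib sum.distrib)
qed

lemma poly_op_smult: "poly_op (smult c p) T = c *\<^sub>R poly_op p T"
  by (simp add: poly_op_altdef[where n = "degree p"] degree_smult_le scaleR_sum_right)

lemma poly_op_diff: "poly_op (p - q) T = poly_op p T - poly_op q T"
  using poly_op_add[of p "- q" T] poly_op_smult[of "- 1" q T] by simp

lemma poly_op_mult_apply: "poly_op (p * q) T x = poly_op p T (poly_op q T x)"
  by (induction p)
    (simp_all add: mult_pCons_left poly_op_add poly_op_smult blinfun.bilinear_simps)

lemma poly_op_commute: "poly_op p T (T x) = T (poly_op p T x)"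
  by (induction p) (simp_all add: blinfun.bilinear_simps)

lemma poly_op_in_bounded_ops: "T \<in> bounded_ops \<Longrightarrow> poly_op p T \<in> bounded_ops"
  by (induction p)
    (simp_all add: bounded_ops_0 poly_op_pCons bounded_ops_add bounded_ops_scaleR
      bounded_ops_compose bounded_ops_id)

lemma symmetric_poly_op:
  assumes "symmetric_op T"
  shows "symmetric_op (poly_op p T)"
proof (induction p)
  case 0
  then show ?case by (simp add: symmetric_op_def rinner.zero_left rinner.zero_right)
next
  case (pCons a p)
  then show ?case
    using assms by (simp add: symmetric_op_def rinner_add_left rinner_add_right
        rinner_scaleR_left rinner_scaleR_right poly_op_commute)
qed

lemma continuous_on_poly_op:
  assumes "continuous_on S B"
  shows "continuous_on S (\<lambda>t. poly_op p (B t))"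
proof (induction p)
  case (pCons a p)
  then show ?case
    unfolding poly_op_pCons
    by (intro continuous_intros bounded_bilinear.continuous_on[OF bounded_bilinear_blinfun_compose]
        assms)
qed simp

section \<open>The norm of a polynomial in a symmetric operator\<close>


text \<open>A lower bound makes the range closed, and a vector orthogonal to the range lies in the kernel by
  symmetry, so it is zero.\<close>

lemma symmetric_bounded_below_bij:
  fixes N :: "'a::complex_hilbert_space \<Rightarrow>\<^sub>L 'a"
  assumes sym: "symmetric_op N" and c: "0 < c" "\<And>x. c * norm x \<le> norm (N x)"
  shows "bij (blinfun_apply N)"
proof (rule bijI)
  have ker: "x = 0" if "N x = 0" for x
    using c(2)[of x] that \<open>0 < c\<close> by (simp add: mult_le_0_iff)
  show "inj (blinfun_apply N)"
    by (rule injI) (metis blinfun.diff_right eq_iff_diff_eq_0 ker)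
  have sub: "subspace (range (blinfun_apply N))"
    by (rule linear_subspace_image[OF bounded_linear.linear[OF blinfun.bounded_linear_right]]) simp
  have "complete (range (blinfun_apply N))"
    by (rule complete_isometric_image[of c])
      (use c blinfun.bounded_linear_right[of N] complete_UNIV in \<open>auto simp: mult.commute\<close>)
  then have "closed (range (blinfun_apply N))" by (rule complete_imp_closed)
  have "y \<in> range (blinfun_apply N)" for y
  proof -
    obtain z where z: "z \<in> range (blinfun_apply N)"
      "\<And>w. w \<in> range (blinfun_apply N) \<Longrightarrow> rinner (y - z) w = 0"
      using orthogonal_projection_exists[OF sub \<open>closed _\<close>] by metis
    have "rinner (N (y - z)) (N (y - z)) = 0"
      using z(2)[of "N (N (y - z))"] symmetric_opD[OF sym, of "y - z" "N (y - z)"] by simp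
    then have "N (y - z) = 0" by (simp add: rinner_self)
    with ker have "y - z = 0" by blast
    with z(1) show ?thesis by simp
  qed
  then show "surj (blinfun_apply N)" by blast
qed

text \<open>The inverse of the bijection \<open>T - l\<close> is bounded by \<open>1/c\<close> and inherits complex linearity, so it
  is an admissible resolvent.\<close>

lemma not_in_op_spectrum:
  fixes T :: "'a::complex_hilbert_space \<Rightarrow>\<^sub>L 'a"
  assumes T: "T \<in> bounded_ops" "symmetric_op T"
    and c: "0 < c" "\<And>x. c * norm x \<le> norm (T x - l *\<^sub>R x)"
  shows "complex_of_real l \<notin> op_spectrum T"
proof -
  define N where "N = T - l *\<^sub>R id_blinfun"
  have N: "N x = T x - l *\<^sub>R x" for x by (simp add: N_def blinfun.bilinear_simps)
  have "symmetric_op N"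
    using T(2) by (simp add: symmetric_op_def N rinner_diff_left rinner_diff_right
        rinner_scaleR_left rinner_scaleR_right)
  then have bij: "bij (blinfun_apply N)"
    by (rule symmetric_bounded_below_bij[OF _ c(1)]) (simp add: N c(2))
  have Nb: "N \<in> bounded_ops"
    using T(1) by (simp add: bounded_ops_def N scaleC_diff_right scaleC_scaleR)
  let ?g = "inv (blinfun_apply N)"
  have gN: "?g (N x) = x" and Ng: "N (?g x) = x" for x
    using bij by (auto simp: bij_is_inj bij_is_surj surj_f_inv_f)
  have "bounded_linear ?g"
  proof (rule bounded_linear_intro[of _ "1 / c"])
    show "?g (x + y) = ?g x + ?g y" for x y
      by (metis gN Ng blinfun.add_right)
    show "?g (s *\<^sub>R x) = s *\<^sub>R ?g x" for s x
      by (metis gN Ng blinfun.scaleR_right)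
    show "norm (?g x) \<le> norm x * (1 / c)" for x
      using c(2)[of "?g x"] c(1) by (simp add: N[symmetric] Ng field_simps)
  qed
  then have ap: "blinfun_apply (Blinfun ?g) = ?g" by (rule bounded_linear_Blinfun_apply)
  have "?g (scaleC k x) = scaleC k (?g x)" for k x
    by (metis gN Ng bounded_opsD[OF Nb])
  then have "Blinfun ?g \<in> bounded_ops" by (simp add: bounded_ops_def ap)
  moreover have "\<forall>x. Blinfun ?g (T x - scaleC (complex_of_real l) x) = x \<and>
      T (Blinfun ?g x) - scaleC (complex_of_real l) (Blinfun ?g x) = x"
    by (simp add: ap scaleC_of_real N[symmetric] gN Ng)
  ultimately show ?thesis by (auto simp: op_spectrum_def)
qed

lemma bounded_below_off_op_spectrum:
  fixes T :: "'a::complex_hilbert_space \<Rightarrow>\<^sub>L 'a"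
  assumes "complex_of_real l \<notin> op_spectrum T"
  obtains c where "0 < c" "\<And>x. c * norm x \<le> norm (T x - l *\<^sub>R x)"
proof -
  obtain S :: "'a \<Rightarrow>\<^sub>L 'a" where S: "\<And>x. S (T x - l *\<^sub>R x) = x"
    using assms by (auto simp: op_spectrum_def scaleC_of_real)
  have pos: "0 < norm S + 1" by (simp add: add_nonneg_pos)
  have "1 / (norm S + 1) * norm x \<le> norm (T x - l *\<^sub>R x)" for x
  proof -
    have "norm x \<le> norm S * norm (T x - l *\<^sub>R x)"
      using norm_blinfun[of S "T x - l *\<^sub>R x"] by (simp add: S)
    also have "\<dots> \<le> (norm S + 1) * norm (T x - l *\<^sub>R x)" by (intro mult_right_mono) auto
    finally show ?thesis using pos by (simp add: field_simps)
  qed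
  moreover have "0 < 1 / (norm S + 1)" using pos by simp
  ultimately show thesis by (rule that[rotated])
qed

text \<open>For \<open>l < 0\<close> positivity gives \<open>T - l \<ge> - l > 0\<close>, and for \<open>l > \<parallel>T\<parallel>\<close> the triangle inequality
  bounds \<open>T - l\<close> below; in both cases \<open>l\<close> is not in the spectrum.\<close>

lemma op_spectrum_positive_op:
  assumes T: "positive_op T" and l: "complex_of_real l \<in> op_spectrum T"
  shows "l \<in> {0..norm T}"
proof -
  have T': "T \<in> bounded_ops" "symmetric_op T" and pos: "\<And>x. 0 \<le> rinner (T x) x"
    using T by (auto simp: positive_op_def)
  have "0 \<le> l"
  proof (rule ccontr)
    assume "\<not> 0 \<le> l"
    have "- l * norm x \<le> norm (T x - l *\<^sub>R x)" for x
    proof (cases "x = 0")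
      case False
      have "- l * norm x * norm x \<le> rinner (T x - l *\<^sub>R x) x"
        using pos[of x]
        by (simp add: rinner_diff_left rinner_scaleR_left rinner_self power2_eq_square)
      also have "\<dots> \<le> norm (T x - l *\<^sub>R x) * norm x"
        using rinner_le_norm abs_le_D1 by blast
      finally show ?thesis by (rule mult_right_le_imp_le) (use False in simp)
    qed simp
    with \<open>\<not> 0 \<le> l\<close> show False using not_in_op_spectrum[OF T', of "- l"] l by auto
  qed
  moreover have "l \<le> norm T"
  proof (rule ccontr)
    assume "\<not> l \<le> norm T"
    have "(l - norm T) * norm x \<le> norm (T x - l *\<^sub>R x)" for x
    proof -
      have "l * norm x \<le> norm (T x) + norm (T x - l *\<^sub>R x)"
        using norm_triangle_ineq4[of "T x" "T x - l *\<^sub>R x"] \<open>0 \<le> l\<close> by simp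
      then show ?thesis using norm_blinfun[of T x] by (simp add: left_diff_distrib)
    qed
    with \<open>\<not> l \<le> norm T\<close> show False
      using not_in_op_spectrum[OF T', of "l - norm T"] l by auto
  qed
  ultimately show ?thesis by simp
qed

lemma map_poly_of_real_add:
  "map_poly complex_of_real (p + q) = map_poly complex_of_real p + map_poly complex_of_real q"
  by (rule poly_eqI) (simp add: coeff_map_poly)

lemma map_poly_of_real_mult:
  "map_poly complex_of_real (p * q) = map_poly complex_of_real p * map_poly complex_of_real q"
  by (induction p) (simp_all add: mult_pCons_left map_poly_of_real_add map_poly_smult map_poly_pCons)


text \<open>The divisor is \<open>(X - z) (X - cnj z)\<close>. Division leaves a remainder of degree at most one that
  vanishes at the non-real point \<open>z\<close>, hence is zero.\<close>

lemma real_quadratic_dvd_if_nonreal_root: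
  fixes q :: "real poly"
  assumes "poly (map_poly complex_of_real q) z = 0" "Im z \<noteq> 0"
  shows "[:(Re z)\<^sup>2 + (Im z)\<^sup>2, - 2 * Re z, 1:] dvd q"
proof -
  define d where "d = [:(Re z)\<^sup>2 + (Im z)\<^sup>2, - 2 * Re z, 1:]"
  define r where "r = q mod d"
  have dz: "poly (map_poly complex_of_real d) z = 0"
    by (simp add: d_def map_poly_pCons complex_eq_iff power2_eq_square algebra_simps)
  have "q = d * (q div d) + r" by (simp add: r_def)
  then have "poly (map_poly complex_of_real r) z = 0"
    using assms(1) dz by (metis add_0 map_poly_of_real_add map_poly_of_real_mult mult_zero_left
        poly_add poly_mult)
  moreover have "degree r < 2"
    using degree_mod_less[of d q] by (auto simp: r_def d_def)
  then obtain a b where "r = [:a, b:]"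
    by (metis One_nat_def Suc_1 degree1_coeffs degree0_coeffs less_2_cases pCons_0_0)
  ultimately have "a = 0" "b = 0"
    using assms(2) by (auto simp: map_poly_pCons complex_eq_iff)
  then show ?thesis using \<open>r = [:a, b:]\<close> by (simp add: r_def d_def dvd_eq_mod_eq_0)
qed


text \<open>Over the reals \<open>q\<close> is a product of linear factors \<open>X - l\<close>, for which \<open>l\<close> is off the spectrum and
  so \<open>T - l\<close> is bounded below, and of factors \<open>(X - a)\<^sup>2 + b\<^sup>2\<close> with \<open>b \<noteq> 0\<close>, whose value at \<open>T\<close>
  is at least \<open>b\<^sup>2\<close> by symmetry. Lower bounds multiply along the product.\<close>

lemma poly_op_bounded_below:
  fixes T :: "'a::complex_hilbert_space \<Rightarrow>\<^sub>L 'a"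
  assumes T: "symmetric_op T"
    and "q \<noteq> 0" "\<And>x. complex_of_real x \<in> op_spectrum T \<Longrightarrow> poly q x \<noteq> 0"
  shows "\<exists>c>0. \<forall>x. c * norm x \<le> norm (poly_op q T x)"
  using assms(2,3)
proof (induction "degree q" arbitrary: q rule: less_induct)
  case less
  have step: ?case
    if q: "q = d * k" and deg: "degree d \<noteq> 0"
      and c: "0 < c" "\<And>x. c * norm x \<le> norm (poly_op d T x)" for d k c
  proof -
    have "degree k < degree q"
      using deg less.prems(1) unfolding q by (subst degree_mult_eq) auto
    moreover have "k \<noteq> 0" "\<And>x. complex_of_real x \<in> op_spectrum T \<Longrightarrow> poly k x \<noteq> 0"
      using less.prems unfolding q by auto
    ultimately obtain c' where c': "0 < c'" "\<And>x. c' * norm x \<le> norm (poly_op k T x)"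
      using less.hyps by blast
    have "c * c' * norm x \<le> norm (poly_op q T x)" for x
    proof -
      have "c * (c' * norm x) \<le> c * norm (poly_op k T x)"
        using c'(2)[of x] c(1) by (intro mult_left_mono) auto
      also have "\<dots> \<le> norm (poly_op q T x)" using c(2) by (simp add: q poly_op_mult_apply)
      finally show ?thesis by (simp add: mult.assoc)
    qed
    with c(1) c'(1) show ?thesis by (intro exI[of _ "c * c'"]) auto
  qed
  show ?case
  proof (cases "degree q = 0")
    case True
    then obtain a where a: "q = [:a:]" by (rule degree_eq_zeroE)
    then show ?thesis using less.prems(1) by (intro exI[of _ "\<bar>a\<bar>"]) (auto simp: blinfun.bilinear_simps)
  next
    case False
    have "\<not> constant (poly (map_poly complex_of_real q))"
      using False by (simp add: constant_degree degree_map_poly)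
    then obtain z where z: "poly (map_poly complex_of_real q) z = 0"
      using fundamental_theorem_of_algebra by blast
    show ?thesis
    proof (cases "Im z = 0")
      case True
      then have "z = complex_of_real (Re z)" by (simp add: complex_eq_iff)
      moreover have "poly (map_poly complex_of_real p) (complex_of_real x) = complex_of_real (poly p x)"
        for p x by (induction p) (simp_all add: map_poly_pCons)
      ultimately have root: "poly q (Re z) = 0" using z by (metis of_real_eq_0_iff)
      then obtain k where k: "q = [:- Re z, 1:] * k" by (auto simp: poly_eq_0_iff_dvd)
      have "complex_of_real (Re z) \<notin> op_spectrum T" using root less.prems(2) by blast
      then obtain c where "0 < c" "\<And>x. c * norm x \<le> norm (T x - Re z *\<^sub>R x)"
        by (rule bounded_below_off_op_spectrum) blast
      then show ?thesis by (intro step[OF k, of c]) (auto simp: blinfun.bilinear_simps)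
    next
      case False
      define d where "d = [:(Re z)\<^sup>2 + (Im z)\<^sup>2, - 2 * Re z, 1:]"
      obtain k where k: "q = d * k"
        using real_quadratic_dvd_if_nonreal_root[OF z False] by (auto simp: d_def)
      have "(Im z)\<^sup>2 * norm x \<le> norm (poly_op d T x)" for x
      proof (cases "x = 0")
        case nz: False
        have "rinner (poly_op d T x) x
            = rinner (T x - Re z *\<^sub>R x) (T x - Re z *\<^sub>R x) + (Im z)\<^sup>2 * rinner x x"
          using symmetric_opD[OF T, of x x] symmetric_opD[OF T, of "T x" x]
          by (simp add: d_def blinfun.bilinear_simps rinner_add_left
              rinner_diff_left rinner_diff_right rinner_scaleR_left rinner_scaleR_right
              power2_eq_square algebra_simps)
        then have "(Im z)\<^sup>2 * norm x * norm x \<le> rinner (poly_op d T x) x"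
          by (simp add: rinner_self power2_eq_square)
        also have "\<dots> \<le> norm (poly_op d T x) * norm x"
          using rinner_le_norm abs_le_D1 by blast
        finally show ?thesis by (rule mult_right_le_imp_le) (use nz in simp)
      qed simp
      then show ?thesis
        using False by (intro step[OF k, of "(Im z)\<^sup>2"]) (auto simp: d_def)
    qed
  qed
qed


text \<open>By symmetry \<open>\<parallel>(S\<^sup>2 - \<parallel>S\<parallel>\<^sup>2) x\<parallel>\<^sup>2 \<le> \<parallel>S\<parallel>\<^sup>2 (\<parallel>S\<parallel>\<^sup>2 \<parallel>x\<parallel>\<^sup>2 - \<parallel>S x\<parallel>\<^sup>2)\<close>. If the left side were
  at least \<open>c\<^sup>2 \<parallel>x\<parallel>\<^sup>2\<close> for all \<open>x\<close>, then \<open>\<parallel>S x\<parallel> / \<parallel>x\<parallel>\<close> would stay uniformly below \<open>\<parallel>S\<parallel>\<close>.\<close>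

lemma symmetric_square_not_bounded_below:
  fixes S :: "'a::complex_hilbert_space \<Rightarrow>\<^sub>L 'a"
  assumes S: "symmetric_op S" and nz: "(u::'a) \<noteq> 0" and c: "0 < c"
  shows "\<exists>x. norm (S (S x) - (norm S)\<^sup>2 *\<^sub>R x) < c * norm x"
proof (rule ccontr)
  assume "\<not> ?thesis"
  then have below: "c * norm x \<le> norm (S (S x) - (norm S)\<^sup>2 *\<^sub>R x)" for x
    by (simp add: not_less)
  define s where "s = norm S"
  have "s \<noteq> 0"
  proof
    assume "s = 0"
    then have "S = 0" by (simp add: s_def)
    then show False using below[of u] nz c by (simp add: mult_le_0_iff)
  qed
  then have s: "0 < s" by (simp add: s_def)
  \<comment> \<open>truncated at zero only so that \<open>sqrt k\<close> is a norm bound without a case distinction\<close>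
  define k where "k = max 0 (s\<^sup>2 - c\<^sup>2 / s\<^sup>2)"
  have bound: "(norm (S x))\<^sup>2 \<le> k * (norm x)\<^sup>2" for x
  proof -
    have "(c * norm x)\<^sup>2 \<le> (norm (S (S x) - s\<^sup>2 *\<^sub>R x))\<^sup>2"
      using below[of x] c by (intro power_mono) (auto simp: s_def)
    also have "\<dots> = (norm (S (S x)))\<^sup>2 - 2 * s\<^sup>2 * (norm (S x))\<^sup>2 + s\<^sup>2 * s\<^sup>2 * (norm x)\<^sup>2"
      using norm_add_scaleR_squared[of "S (S x)" "- s\<^sup>2" x] symmetric_opD[OF S, of "S x" x]
      by (simp add: rinner_self power2_eq_square)
    also have "(norm (S (S x)))\<^sup>2 \<le> s\<^sup>2 * (norm (S x))\<^sup>2"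
      using norm_blinfun[of S "S x"] unfolding s_def power_mult_distrib[symmetric]
      by (intro power_mono) auto
    finally have "s\<^sup>2 * (norm (S x))\<^sup>2 \<le> s\<^sup>2 * s\<^sup>2 * (norm x)\<^sup>2 - c\<^sup>2 * (norm x)\<^sup>2"
      by (simp add: power_mult_distrib)
    also have "\<dots> = s\<^sup>2 * ((s\<^sup>2 - c\<^sup>2 / s\<^sup>2) * (norm x)\<^sup>2)"
      using s by (simp add: field_simps)
    finally have "(norm (S x))\<^sup>2 \<le> (s\<^sup>2 - c\<^sup>2 / s\<^sup>2) * (norm x)\<^sup>2"
      using s by simp
    also have "\<dots> \<le> k * (norm x)\<^sup>2" by (intro mult_right_mono) (auto simp: k_def)
    finally show ?thesis .
  qed
  have "norm S \<le> sqrt k"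
  proof (rule norm_blinfun_bound)
    fix x
    have "(norm (S x))\<^sup>2 \<le> (sqrt k * norm x)\<^sup>2"
      using bound[of x] by (simp add: power_mult_distrib k_def)
    then show "norm (S x) \<le> sqrt k * norm x"
      by (rule power2_le_imp_le) (simp add: k_def)
  qed (simp add: k_def)
  then have "s\<^sup>2 \<le> k"
    using s by (metis s_def norm_ge_zero real_sqrt_ge_0_iff order_trans power_mono real_sqrt_pow2)
  moreover have "k < s\<^sup>2" using s c by (simp add: k_def)
  ultimately show False by simp
qed


text \<open>For \<open>S = p(T)\<close> the nonzero polynomial \<open>p\<^sup>2 - \<parallel>S\<parallel>\<^sup>2\<close> must have a zero on the spectrum, because
  its value at \<open>T\<close> is not bounded below.\<close>

lemma norm_poly_op_attained:
  fixes T :: "'a::complex_hilbert_space \<Rightarrow>\<^sub>L 'a"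
  assumes T: "symmetric_op T" and nz: "(u::'a) \<noteq> 0" and ne: "p * p \<noteq> [:(norm (poly_op p T))\<^sup>2:]"
  obtains x where "complex_of_real x \<in> op_spectrum T" "\<bar>poly p x\<bar> = norm (poly_op p T)"
proof -
  define S where "S = poly_op p T"
  define q where "q = p * p - [:(norm S)\<^sup>2:]"
  have "q \<noteq> 0" using ne by (simp add: q_def S_def)
  have "poly_op q T x = S (S x) - (norm S)\<^sup>2 *\<^sub>R x" for x
    by (simp add: q_def poly_op_diff blinfun.bilinear_simps poly_op_mult_apply S_def)
  then have "\<not> (\<exists>c>0. \<forall>x. c * norm x \<le> norm (poly_op q T x))"
    using symmetric_square_not_bounded_below[OF symmetric_poly_op[OF T, of p] nz]
    by (metis S_def not_le)
  then obtain x where x: "complex_of_real x \<in> op_spectrum T" "poly q x = 0"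
    using poly_op_bounded_below[OF T \<open>q \<noteq> 0\<close>] by blast
  then have "(poly p x)\<^sup>2 = (norm S)\<^sup>2" by (simp add: q_def power2_eq_square)
  then have "\<bar>poly p x\<bar> = norm S" by (metis abs_norm_cancel power2_eq_iff abs_minus_cancel)
  with x that show thesis by (simp add: S_def)
qed

text \<open>The square of the polynomial \<open>X\<close> is not constant, so the norm of \<open>T\<close> is attained on the
  spectrum.\<close>

lemma op_spectrum_nonempty:
  fixes T :: "'a::complex_hilbert_space \<Rightarrow>\<^sub>L 'a"
  assumes T: "symmetric_op T" and nz: "(u::'a) \<noteq> 0"
  obtains x where "complex_of_real x \<in> op_spectrum T"
proof -
  have "degree ([:0, 1:] * [:0, 1 :: real:]) \<noteq> 0" by (simp add: degree_mult_eq)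
  then have "[:0, 1:] * [:0, 1:] \<noteq> [:(norm (poly_op [:0, 1:] T))\<^sup>2:]"
    by (metis degree_pCons_0)
  from norm_poly_op_attained[OF T nz this] that show thesis by blast
qed

text \<open>If \<open>p\<^sup>2\<close> is the constant \<open>\<parallel>p(T)\<parallel>\<^sup>2\<close>, the norm is attained at every point of the spectrum,
  which is nonempty; otherwise the norm is attained at some point. The zero space, where the
  spectrum is empty, has only the zero operator. This bound on the spectrum alone, and not on an
  interval around it, is what makes the functional calculus well defined.\<close>

lemma norm_poly_op_le:
  fixes T :: "'a::complex_hilbert_space \<Rightarrow>\<^sub>L 'a"
  assumes T: "symmetric_op T" and e: "0 \<le> e"
    and le: "\<And>x. complex_of_real x \<in> op_spectrum T \<Longrightarrow> \<bar>poly p x\<bar> \<le> e"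
  shows "norm (poly_op p T) \<le> e"
proof (cases "\<exists>u::'a. u \<noteq> 0")
  case True
  then obtain u :: 'a where u: "u \<noteq> 0" by blast
  show ?thesis
  proof (cases "p * p = [:(norm (poly_op p T))\<^sup>2:]")
    case True
    obtain x where x: "complex_of_real x \<in> op_spectrum T" using op_spectrum_nonempty[OF T u] .
    have "(poly p x)\<^sup>2 = (norm (poly_op p T))\<^sup>2"
      using arg_cong[OF True, of "\<lambda>q. poly q x"] by (simp add: power2_eq_square)
    then have "\<bar>poly p x\<bar> = norm (poly_op p T)"
      by (metis abs_norm_cancel power2_eq_iff abs_minus_cancel)
    with le[OF x] show ?thesis by simp
  next
    case False
    then show ?thesis using norm_poly_op_attained[OF T u False] le by metis
  qed
next
  case False
  then have "poly_op p T = 0" by (intro blinfun_eqI) auto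
  with e show ?thesis by simp
qed

section \<open>Continuous functional calculus\<close>

lemma Weierstrass_poly_sequence:
  fixes f :: "real \<Rightarrow> real"
  assumes "continuous_on {a..b} f"
  obtains p :: "nat \<Rightarrow> real poly" where "uniform_limit {a..b} (\<lambda>n x. poly (p n) x) f sequentially"
proof -
  have "\<exists>q. \<forall>x\<in>{a..b}. \<bar>f x - poly q x\<bar> < inverse (real (Suc n))" for n
  proof -
    obtain g where g: "real_polynomial_function g" "\<And>x. x \<in> {a..b} \<Longrightarrow> \<bar>f x - g x\<bar> < inverse (real (Suc n))"
      using Stone_Weierstrass_real_polynomial_function[OF compact_Icc assms, of "inverse (real (Suc n))"]
      by auto
    from g(1) obtain c m where c: "g = (\<lambda>x. \<Sum>i\<le>m. c i * x ^ i)"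
      by (auto simp: real_polynomial_function_iff_sum)
    have "g x = poly (\<Sum>i\<le>m. monom (c i) i) x" for x
      by (simp add: c poly_sum poly_monom)
    with g(2) show ?thesis by metis
  qed
  then obtain p where p: "\<And>n x. x \<in> {a..b} \<Longrightarrow> \<bar>f x - poly (p n) x\<bar> < inverse (real (Suc n))"
    by metis
  have "uniform_limit {a..b} (\<lambda>n x. poly (p n) x) f sequentially"
  proof (rule uniform_limitI)
    fix e :: real assume "e > 0"
    then obtain N where N: "inverse (real (Suc N)) < e" using reals_Archimedean by blast
    have "\<forall>x\<in>{a..b}. dist (poly (p n) x) (f x) < e" if "n \<ge> N" for n
    proof
      fix x assume "x \<in> {a..b}"
      have "inverse (real (Suc n)) \<le> inverse (real (Suc N))"
        using that by (intro le_imp_inverse_le) auto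
      then show "dist (poly (p n) x) (f x) < e"
        using p[OF \<open>x \<in> _\<close>, of n] N unfolding dist_real_def by linarith
    qed
    then show "\<forall>\<^sub>F n in sequentially. \<forall>x\<in>{a..b}. dist (poly (p n) x) (f x) < e"
      by (auto simp: eventually_sequentially)
  qed
  then show thesis by (rule that)
qed

lemma poly_op_close:
  assumes T: "symmetric_op T" and "0 \<le> d" "0 \<le> e"
    and "\<And>x. complex_of_real x \<in> op_spectrum T \<Longrightarrow> \<bar>poly p x - f x\<bar> \<le> d"
    and "\<And>x. complex_of_real x \<in> op_spectrum T \<Longrightarrow> \<bar>poly q x - f x\<bar> \<le> e"
  shows "norm (poly_op p T - poly_op q T) \<le> d + e"
proof -
  have "norm (poly_op (p - q) T) \<le> d + e"
  proof (rule norm_poly_op_le[OF T])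
    fix x assume "complex_of_real x \<in> op_spectrum T"
    from assms(4)[OF this] assms(5)[OF this] show "\<bar>poly (p - q) x\<bar> \<le> d + e" by simp
  qed (use assms in auto)
  then show ?thesis by (simp add: poly_op_diff)
qed

text \<open>Two polynomial sequences that approximate \<open>f\<close> on the spectrum are uniformly close there, hence
  close in norm at \<open>T\<close>; this is the uniqueness behind the definite description.\<close>

lemma op_fun_calc_eqI:
  assumes T: "symmetric_op T"
    and p: "uniform_limit {x. complex_of_real x \<in> op_spectrum T} (\<lambda>n x. poly (p n) x) f sequentially"
    and S: "(\<lambda>n. poly_op (p n) T) \<longlonglongrightarrow> S"
  shows "op_fun_calc f T = S"
  unfolding op_fun_calc_def
proof (rule the_equality)
  show "S' = S" if S': "\<exists>q. uniform_limit {x. complex_of_real x \<in> op_spectrum T} (\<lambda>n x. poly (q n) x) f sequentially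
      \<and> (\<lambda>n. poly_op (q n) T) \<longlonglongrightarrow> S'" for S'
  proof -
    obtain q where q: "uniform_limit {x. complex_of_real x \<in> op_spectrum T} (\<lambda>n x. poly (q n) x) f sequentially"
      and q': "(\<lambda>n. poly_op (q n) T) \<longlonglongrightarrow> S'"
      using S' by blast
    have "(\<lambda>n. poly_op (p n) T - poly_op (q n) T) \<longlonglongrightarrow> 0"
    proof (rule tendstoI)
      fix e :: real assume "e > 0"
      then have "e / 3 > 0" by simp
      from eventually_conj[OF uniform_limitD[OF p this] uniform_limitD[OF q this]]
      show "\<forall>\<^sub>F n in sequentially. dist (poly_op (p n) T - poly_op (q n) T) 0 < e"
      proof eventually_elim
        case (elim n)
        then have "norm (poly_op (p n) T - poly_op (q n) T) \<le> e / 3 + e / 3"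
          using \<open>e > 0\<close> by (intro poly_op_close[OF T, where f = f]) (auto simp: dist_real_def less_imp_le)
        with \<open>e > 0\<close> show ?case by simp
      qed
    qed
    moreover have "(\<lambda>n. poly_op (p n) T - poly_op (q n) T) \<longlonglongrightarrow> S - S'"
      by (intro tendsto_diff S q')
    ultimately have "S - S' = 0" by (rule LIMSEQ_unique[rotated])
    then show ?thesis by simp
  qed
qed (use p S in blast)

text \<open>Approximation on all of \<open>{0..K}\<close> lets one sequence serve every positive operator of norm at most
  \<open>K\<close>, whatever its spectrum.\<close>

lemma op_fun_calc_limit:
  assumes T: "positive_op T" and K: "norm T \<le> K"
    and p: "uniform_limit {0..K} (\<lambda>n x. poly (p n) x) f sequentially"
  shows "(\<lambda>n. poly_op (p n) T) \<longlonglongrightarrow> op_fun_calc f T"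
proof -
  have sym: "symmetric_op T" using T by (simp add: positive_op_def)
  have sub: "{x. complex_of_real x \<in> op_spectrum T} \<subseteq> {0..K}"
    using op_spectrum_positive_op[OF T] K by fastforce
  have "Cauchy (\<lambda>n. poly_op (p n) T)"
  proof (rule metric_CauchyI)
    fix e :: real assume "e > 0"
    then have "e / 3 > 0" by simp
    from uniform_limitD[OF p this] obtain N
      where N: "\<And>n x. n \<ge> N \<Longrightarrow> x \<in> {0..K} \<Longrightarrow> \<bar>poly (p n) x - f x\<bar> < e / 3"
      unfolding eventually_sequentially dist_real_def by blast
    have "dist (poly_op (p m) T) (poly_op (p n) T) < e" if "m \<ge> N" "n \<ge> N" for m n
    proof -
      have "norm (poly_op (p m) T - poly_op (p n) T) \<le> e / 3 + e / 3"
        using N[OF that(1)] N[OF that(2)] sub \<open>e > 0\<close>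
        by (intro poly_op_close[OF sym, where f = f]) (auto simp: less_imp_le)
      with \<open>e > 0\<close> show ?thesis by (simp add: dist_norm)
    qed
    then show "\<exists>N. \<forall>m\<ge>N. \<forall>n\<ge>N. dist (poly_op (p m) T) (poly_op (p n) T) < e" by blast
  qed
  then obtain S where S: "(\<lambda>n. poly_op (p n) T) \<longlonglongrightarrow> S"
    using Cauchy_convergent_iff convergent_def by blast
  moreover have "op_fun_calc f T = S"
    using uniform_limit_on_subset[OF p sub] S by (rule op_fun_calc_eqI[OF sym])
  ultimately show ?thesis by simp
qed


text \<open>The norm bound, the comparison with affine functions and the continuity in the operator are all
  instances of this estimate.\<close>

lemma op_fun_calc_close_poly_op:
  assumes T: "positive_op T" and K: "norm T \<le> K" and f: "continuous_on {0..K} f"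
    and e: "\<And>x. x \<in> {0..K} \<Longrightarrow> \<bar>f x - poly q x\<bar> \<le> e"
  shows "norm (op_fun_calc f T - poly_op q T) \<le> e"
proof -
  have sym: "symmetric_op T" using T by (simp add: positive_op_def)
  have sub: "x \<in> {0..K}" if "complex_of_real x \<in> op_spectrum T" for x
    using op_spectrum_positive_op[OF T that] K by auto
  have "0 \<le> K" using K norm_ge_zero order_trans by blast
  then have "0 \<le> e" using e[of 0] by (intro order_trans[OF abs_ge_zero]) auto
  obtain p where p: "uniform_limit {0..K} (\<lambda>n x. poly (p n) x) f sequentially"
    using Weierstrass_poly_sequence[OF f] .
  have lim: "(\<lambda>n. norm (poly_op (p n) T - poly_op q T)) \<longlonglongrightarrow> norm (op_fun_calc f T - poly_op q T)"
    by (intro tendsto_intros op_fun_calc_limit[OF T K p])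
  show ?thesis
  proof (rule field_le_epsilon)
    fix d :: real assume "d > 0"
    from uniform_limitD[OF p this]
    have "\<forall>\<^sub>F n in sequentially. norm (poly_op (p n) T - poly_op q T) \<le> e + d"
    proof eventually_elim
      case (elim n)
      then have "norm (poly_op (p n) T - poly_op q T) \<le> d + e"
        using \<open>d > 0\<close> \<open>0 \<le> e\<close> sub e
        by (intro poly_op_close[OF sym, where f = f])
          (auto simp: dist_real_def less_imp_le abs_minus_commute)
      then show ?case by simp
    qed
    with lim show "norm (op_fun_calc f T - poly_op q T) \<le> e + d"
      by (rule tendsto_upperbound) simp
  qed
qed

lemma norm_op_fun_calc_le:
  assumes "positive_op T" "norm T \<le> K" "continuous_on {0..K} f"
    and "\<And>x. x \<in> {0..K} \<Longrightarrow> \<bar>f x\<bar> \<le> M"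
  shows "norm (op_fun_calc f T) \<le> M"
  using op_fun_calc_close_poly_op[OF assms(1-3), of 0 M] assms(4) by simp


text \<open>The function \<open>f - (a + b X)\<close> takes values between \<open>0\<close> and some \<open>2 M\<close>, so it differs from the
  constant \<open>M\<close> by at most \<open>M\<close>. The same then holds in norm at \<open>T\<close>, which leaves
  \<open>f(T) - (a + b T)\<close> at least \<open>M - M = 0\<close>.\<close>

lemma op_fun_calc_ge_affine:
  assumes T: "positive_op T" and K: "norm T \<le> K" and f: "continuous_on {0..K} f"
    and ge: "\<And>x. x \<in> {0..K} \<Longrightarrow> a + b * x \<le> f x"
  shows "a * (norm x)\<^sup>2 + b * rinner (T x) x \<le> rinner (op_fun_calc f T x) x"
proof -
  have "continuous_on {0..K} (\<lambda>x. f x - (a + b * x))"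
    by (intro continuous_intros f)
  then have "bounded ((\<lambda>x. f x - (a + b * x)) ` {0..K})"
    using compact_continuous_image compact_Icc compact_imp_bounded by blast
  then obtain B where "\<forall>y \<in> (\<lambda>x. f x - (a + b * x)) ` {0..K}. norm y \<le> B"
    unfolding bounded_iff by blast
  then have B: "\<bar>f x - (a + b * x)\<bar> \<le> B" if "x \<in> {0..K}" for x
    using that by simp
  define M where "M = B / 2"
  define q where "q = [:a + M, b:]"
  have "norm (op_fun_calc f T - poly_op q T) \<le> M"
  proof (rule op_fun_calc_close_poly_op[OF T K f])
    fix x assume "x \<in> {0..K}"
    moreover have "poly q x = a + M + b * x" by (simp add: q_def)
    ultimately show "\<bar>f x - poly q x\<bar> \<le> M"
      using ge[of x] B[of x] unfolding M_def by linarith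
  qed
  then have "norm (op_fun_calc f T - poly_op q T) * norm x * norm x \<le> M * norm x * norm x"
    by (intro mult_right_mono) auto
  moreover have "- rinner ((op_fun_calc f T - poly_op q T) x) x
      \<le> norm (op_fun_calc f T - poly_op q T) * norm x * norm x"
    by (rule order_trans[OF _ mult_right_mono[OF norm_blinfun]])
      (use rinner_le_norm[of "(op_fun_calc f T - poly_op q T) x" x] in auto)
  ultimately have "- rinner ((op_fun_calc f T - poly_op q T) x) x \<le> M * norm x * norm x"
    by (rule order_trans[rotated])
  then show ?thesis
    by (simp add: q_def blinfun.bilinear_simps rinner_diff_left rinner_add_left rinner_scaleR_left
        rinner_self power2_eq_square algebra_simps)
qed

lemma positive_op_fun_calc:
  assumes T: "positive_op T" and f: "continuous_on {0..norm T} f"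
    and nonneg: "\<And>x. x \<in> {0..norm T} \<Longrightarrow> 0 \<le> f x"
  shows "positive_op (op_fun_calc f T)"
proof -
  obtain p where "uniform_limit {0..norm T} (\<lambda>n x. poly (p n) x) f sequentially"
    using Weierstrass_poly_sequence[OF f] .
  from op_fun_calc_limit[OF T order_refl this]
  have lim: "(\<lambda>n. poly_op (p n) T) \<longlonglongrightarrow> op_fun_calc f T" .
  have T': "T \<in> bounded_ops" "symmetric_op T" using T by (auto simp: positive_op_def)
  have "0 \<le> rinner (op_fun_calc f T x) x" for x
    using op_fun_calc_ge_affine[OF T order_refl f, of 0 0 x] nonneg by simp
  then show ?thesis
    using bounded_ops_limit[OF poly_op_in_bounded_ops[OF T'(1)] lim]
      symmetric_op_limit[OF symmetric_poly_op[OF T'(2)] lim]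
    by (simp add: positive_op_def)
qed

text \<open>A polynomial close to \<open>f\<close> on the common interval \<open>{0..K}\<close> approximates \<open>f(B\<^sub>t)\<close> uniformly
  in \<open>t\<close>.\<close>

lemma continuous_on_op_fun_calc:
  assumes B: "continuous_on S B" "\<And>t. t \<in> S \<Longrightarrow> positive_op (B t)" "\<And>t. t \<in> S \<Longrightarrow> norm (B t) \<le> K"
    and f: "continuous_on {0..K} f"
  shows "continuous_on S (\<lambda>t. op_fun_calc f (B t))"
proof -
  obtain p where p: "uniform_limit {0..K} (\<lambda>n x. poly (p n) x) f sequentially"
    using Weierstrass_poly_sequence[OF f] .
  show ?thesis
  proof (rule uniform_limit_theorem)
    show "\<forall>\<^sub>F n in sequentially. continuous_on S (\<lambda>t. poly_op (p n) (B t))"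
      by (intro always_eventually allI continuous_on_poly_op B)
    show "uniform_limit S (\<lambda>n t. poly_op (p n) (B t)) (\<lambda>t. op_fun_calc f (B t)) sequentially"
    proof (rule uniform_limitI)
      fix e :: real assume "e > 0"
      then have "e / 2 > 0" by simp
      from uniform_limitD[OF p this]
      show "\<forall>\<^sub>F n in sequentially. \<forall>t\<in>S. dist (poly_op (p n) (B t)) (op_fun_calc f (B t)) < e"
      proof eventually_elim
        case (elim n)
        show ?case
        proof
          fix t assume t: "t \<in> S"
          have "norm (op_fun_calc f (B t) - poly_op (p n) (B t)) \<le> e / 2"
            using elim by (intro op_fun_calc_close_poly_op[OF B(2,3)[OF t] f])
              (auto simp: dist_real_def abs_minus_commute less_imp_le)
          with \<open>e > 0\<close> show "dist (poly_op (p n) (B t)) (op_fun_calc f (B t)) < e"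
            by (simp add: dist_norm norm_minus_commute)
        qed
      qed
    qed
  qed simp
qed

section \<open>Powers of positive operators\<close>

lemma continuous_on_powr_Icc:
  fixes r :: real
  assumes "0 < r"
  shows "continuous_on {0..K} (\<lambda>x. x powr r)"
  by (rule continuous_on_powr'[OF continuous_on_id continuous_on_const]) (use assms in simp)

lemma norm_op_powr_le:
  assumes "positive_op T" "norm T \<le> K" "0 < r"
  shows "norm (op_powr T r) \<le> K powr r"
  unfolding op_powr_def
  by (rule norm_op_fun_calc_le[OF assms(1,2) continuous_on_powr_Icc[OF assms(3)]])
    (use assms(3) in \<open>auto intro: powr_mono2\<close>)

text \<open>Convexity is applied on the open half-line; at \<open>s = 0\<close> the tangent has the value
  \<open>(1 - r) c\<^sup>r \<le> 0\<close>.\<close>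

lemma powr_ge_tangent:
  fixes s c r :: real
  assumes "1 \<le> r" "0 < c" "0 \<le> s"
  shows "c powr r + r * c powr (r - 1) * (s - c) \<le> s powr r"
proof (cases "s = 0")
  case True
  have "c powr (r - 1) * c = c powr r" using assms by (simp add: powr_diff)
  then show ?thesis using True assms by (simp add: algebra_simps)
next
  case False
  have "r * c powr (r - 1) * (s - c) \<le> s powr r - c powr r"
  proof (rule convex_on_imp_above_tangent[OF powr_convex[OF assms(1)]])
    show "((\<lambda>x. x powr r) has_real_derivative r * c powr (r - 1)) (at c within {0<..})"
      using assms(2) by (auto intro!: derivative_eq_intros)
  qed (use assms False in \<open>auto simp: interior_open\<close>)
  then show ?thesis by simp
qed

lemma op_powr_ge_tangent:
  assumes T: "positive_op T" and r: "1 \<le> r" and c: "0 < c" and x: "norm x = 1"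
  shows "c powr r + r * c powr (r - 1) * (rinner (T x) x - c) \<le> rinner (op_powr T r x) x"
proof -
  have "(c powr r - r * c powr (r - 1) * c) * (norm x)\<^sup>2 + r * c powr (r - 1) * rinner (T x) x
      \<le> rinner (op_powr T r x) x"
    unfolding op_powr_def
  proof (rule op_fun_calc_ge_affine[OF T order_refl continuous_on_powr_Icc])
    fix s assume "s \<in> {0..norm T}"
    then show "c powr r - r * c powr (r - 1) * c + r * c powr (r - 1) * s \<le> s powr r"
      using powr_ge_tangent[OF r c, of s] by (simp add: algebra_simps)
  qed (use r in simp)
  with x show ?thesis by (simp add: right_diff_distrib)
qed

lemma positive_op_powr: "positive_op T \<Longrightarrow> 0 < r \<Longrightarrow> positive_op (op_powr T r)"
  unfolding op_powr_def
  by (rule positive_op_fun_calc) (auto intro: continuous_on_powr_Icc)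

lemma positive_abs_op: "A \<in> bounded_ops \<Longrightarrow> positive_op (abs_op A)"
  unfolding abs_op_def by (intro positive_op_powr positive_op_adjoint_compose) simp_all

lemma norm_abs_op_le:
  assumes "A \<in> bounded_ops"
  shows "norm (abs_op A) \<le> norm A"
proof -
  have "norm (adjoint_op A o\<^sub>L A) \<le> norm (adjoint_op A) * norm A" by (rule norm_blinfun_compose)
  also have "\<dots> \<le> (norm A)\<^sup>2"
    using norm_adjoint_op_le[OF assms] by (simp add: power2_eq_square mult_right_mono)
  finally have "norm (abs_op A) \<le> ((norm A)\<^sup>2) powr (1/2)"
    unfolding abs_op_def by (intro norm_op_powr_le positive_op_adjoint_compose assms) simp_all
  then show ?thesis by (simp add: powr_half_sqrt)
qed


text \<open>In the real inner product, polarization reads \<open>4 \<langle>M x, y\<rangle> = \<langle>M (x + y), x + y\<rangle> - \<langle>M (x - y), x - y\<rangle>\<close>,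
  where the subtracted term is nonnegative and may be dropped.\<close>

lemma norm_positive_op_le:
  fixes M :: "'a::complex_hilbert_space \<Rightarrow>\<^sub>L 'a"
  assumes M: "positive_op M" and k: "0 \<le> k"
    and le: "\<And>x. norm x = 1 \<Longrightarrow> rinner (M x) x \<le> k"
  shows "norm M \<le> k"
proof (rule norm_blinfun_bound[OF k])
  have le': "rinner (M z) z \<le> k * (norm z)\<^sup>2" for z
  proof (cases "z = 0")
    case False
    have "rinner (M (z /\<^sub>R norm z)) (z /\<^sub>R norm z) \<le> k" by (rule le) (use False in simp)
    then show ?thesis
      using False by (simp add: blinfun.bilinear_simps rinner_scaleR_left rinner_scaleR_right
          field_simps power2_eq_square)
  qed (simp add: rinner.zero_right)
  fix x
  show "norm (M x) \<le> k * norm x"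
  proof (cases "x = 0 \<or> M x = 0")
    case True
    then show ?thesis using k by auto
  next
    case False
    \<comment> \<open>rescale so that both vectors in the polarization have the same norm\<close>
    define y where "y = (norm x / norm (M x)) *\<^sub>R M x"
    have ny: "norm y = norm x" using False by (simp add: y_def)
    have "4 * rinner (M x) y = rinner (M (x + y)) (x + y) - rinner (M (x - y)) (x - y)"
      using M symmetric_opD[of M y x] unfolding positive_op_def
      by (simp add: blinfun.bilinear_simps rinner_add_left rinner_add_right rinner_diff_left
          rinner_diff_right rinner_commute[of y])
    also have "\<dots> \<le> rinner (M (x + y)) (x + y)" using M by (simp add: positive_op_def)
    also have "\<dots> \<le> k * (norm (x + y))\<^sup>2" by (rule le')
    also have "\<dots> \<le> k * (2 * norm x)\<^sup>2"
      using norm_triangle_ineq[of x y] ny by (intro mult_left_mono power_mono k) auto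
    finally have "rinner (M x) y \<le> k * norm x * norm x" by (simp add: power2_eq_square)
    moreover have "rinner (M x) y = norm (M x) * norm x"
      using False by (simp add: y_def rinner_scaleR_right rinner_self power2_eq_square)
    ultimately have "norm (M x) * norm x \<le> k * norm x * norm x" by simp
    then show ?thesis by (rule mult_right_le_imp_le) (use False in simp)
  qed
qed

section \<open>Integrating powers along a segment of positive operators\<close>

definition half_segment ::
    "('a::complex_hilbert_space \<Rightarrow>\<^sub>L 'a) \<Rightarrow> ('a \<Rightarrow>\<^sub>L 'a) \<Rightarrow> real \<Rightarrow> ('a \<Rightarrow>\<^sub>L 'a)"
  where "half_segment P Q t = ((1 - t) *\<^sub>R P + t *\<^sub>R Q) /\<^sub>R 2"

lemma positive_half_segment:
  "positive_op P \<Longrightarrow> positive_op Q \<Longrightarrow> t \<in> {0..1} \<Longrightarrow> positive_op (half_segment P Q t)"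
  unfolding half_segment_def by (intro positive_op_scaleR positive_op_add) auto

lemma norm_half_segment_le:
  assumes "norm P \<le> K" "norm Q \<le> K" "t \<in> {0..1}"
  shows "norm (half_segment P Q t) \<le> K / 2"
proof -
  have "norm ((1 - t) *\<^sub>R P + t *\<^sub>R Q) \<le> (1 - t) * norm P + t * norm Q"
    using assms(3) by (intro order_trans[OF norm_triangle_ineq]) auto
  also have "\<dots> \<le> (1 - t) * K + t * K"
    using assms by (intro add_mono mult_left_mono) auto
  also have "\<dots> = K" by (simp add: algebra_simps)
  finally show ?thesis by (simp add: half_segment_def)
qed

lemma continuous_on_op_powr_half_segment:
  assumes "positive_op P" "positive_op Q" "0 < r"
  shows "continuous_on {0..1} (\<lambda>t. op_powr (half_segment P Q t) r)"
  unfolding op_powr_def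
proof (rule continuous_on_op_fun_calc)
  show "continuous_on {0..1} (half_segment P Q)"
    unfolding half_segment_def by (intro continuous_intros)
  show "norm (half_segment P Q t) \<le> max (norm P) (norm Q) / 2" if "t \<in> {0..1}" for t
    by (rule norm_half_segment_le) (use that in auto)
qed (use assms in \<open>auto intro: positive_half_segment continuous_on_powr_Icc\<close>)

lemma norm_integral_op_powr_half_segment_le:
  assumes "positive_op P" "positive_op Q" "norm P \<le> K" "norm Q \<le> K" "0 < r"
  shows "norm (integral {0..1} (\<lambda>t. op_powr (half_segment P Q t) r)) \<le> (K / 2) powr r"
proof -
  have "norm (integral {0..1} (\<lambda>t. op_powr (half_segment P Q t) r)) \<le> (K / 2) powr r * (1 - 0)"
  proof (rule integral_bound)
    show "norm (op_powr (half_segment P Q t) r) \<le> (K / 2) powr r" if "t \<in> {0..1}" for t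
      using assms that by (intro norm_op_powr_le positive_half_segment norm_half_segment_le)
  qed (use assms in \<open>auto intro: continuous_on_op_powr_half_segment\<close>)
  then show ?thesis by simp
qed


text \<open>Write \<open>B\<^sub>t\<close> for the point of the segment. As \<open>c\<close> is the mean over \<open>t\<close> of \<open>\<langle>B\<^sub>t x, x\<rangle>\<close>, the linear
  term of the tangent inequality at \<open>c\<close> vanishes on integration.\<close>

lemma integral_op_powr_half_segment_ge:
  assumes P: "positive_op P" and Q: "positive_op Q" and r: "1 \<le> r" and x: "norm x = 1"
  defines "c \<equiv> rinner ((P + Q) x) x / 4"
  shows "c powr r \<le> norm (integral {0..1} (\<lambda>t. op_powr (half_segment P Q t) r))"
proof (cases "c = 0")
  case False
  let ?J = "\<lambda>t. op_powr (half_segment P Q t) r"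
  let ?\<phi> = "\<lambda>B. rinner (blinfun_apply B x) x"
  have "positive_op (P + Q)" using P Q by (rule positive_op_add)
  then have c: "0 < c" using False by (simp add: c_def positive_op_def order_less_le)
  have \<phi>: "bounded_linear ?\<phi>"
    by (rule bounded_linear_compose[OF rinner.bounded_linear_left blinfun.bounded_linear_left])
  have J: "?J integrable_on {0..1}"
    using P Q r by (intro integrable_continuous_real continuous_on_op_powr_half_segment) auto
  have mean: "((\<lambda>t. ?\<phi> (half_segment P Q t)) has_integral c) {0..1}"
  proof -
    have "((\<lambda>t. ?\<phi> P / 2 + (?\<phi> Q - ?\<phi> P) / 2 * t) has_integral
        (?\<phi> P / 2 * 1 + (?\<phi> Q - ?\<phi> P) / 4 * 1\<^sup>2) - (?\<phi> P / 2 * 0 + (?\<phi> Q - ?\<phi> P) / 4 * 0\<^sup>2)) {0..1}"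
      by (rule fundamental_theorem_of_calculus)
        (auto simp: has_real_derivative_iff_has_vector_derivative[symmetric]
          intro!: derivative_eq_intros)
    moreover have "?\<phi> (half_segment P Q t) = ?\<phi> P / 2 + (?\<phi> Q - ?\<phi> P) / 2 * t" for t
      by (simp add: half_segment_def blinfun.bilinear_simps rinner_add_left rinner_scaleR_left
          field_simps)
    moreover have "c = (?\<phi> P / 2 * 1 + (?\<phi> Q - ?\<phi> P) / 4 * 1\<^sup>2) - (?\<phi> P / 2 * 0 + (?\<phi> Q - ?\<phi> P) / 4 * 0\<^sup>2)"
      by (simp add: c_def blinfun.bilinear_simps rinner_add_left field_simps)
    ultimately show ?thesis by simp
  qed
  have "((\<lambda>t. c powr r + r * c powr (r - 1) * (?\<phi> (half_segment P Q t) - c)) has_integral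
      c powr r + r * c powr (r - 1) * (c - c)) {0..1}"
    by (intro has_integral_add has_integral_mult_right has_integral_diff mean)
      (use has_integral_const_real[of _ 0 1] in auto)
  moreover have "((\<lambda>t. ?\<phi> (?J t)) has_integral ?\<phi> (integral {0..1} ?J)) {0..1}"
    using has_integral_linear[OF integrable_integral[OF J] \<phi>] by (simp add: o_def)
  ultimately have "c powr r + r * c powr (r - 1) * (c - c) \<le> ?\<phi> (integral {0..1} ?J)"
    by (rule has_integral_le) (intro op_powr_ge_tangent positive_half_segment P Q r c x)
  also have "\<dots> \<le> norm (integral {0..1} ?J x) * norm x"
    using rinner_le_norm abs_le_D1 by blast
  also have "\<dots> \<le> norm (integral {0..1} ?J)"
    using norm_blinfun[of "integral {0..1} ?J" x] x by simp
  finally show ?thesis by simp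
qed simp

text \<open>Taking \<open>r\<close>-th roots makes the bound at each unit vector linear in \<open>\<langle>(P + Q) x, x\<rangle>\<close>, the form
  in which the quadratic form controls the norm.\<close>

lemma norm_powr_le_norm_integral_op_powr_half_segment:
  assumes P: "positive_op P" and Q: "positive_op Q" and r: "1 \<le> r"
  shows "(norm (P + Q) / 4) powr r \<le> norm (integral {0..1} (\<lambda>t. op_powr (half_segment P Q t) r))"
    (is "_ \<le> ?I")
proof -
  have "norm (P + Q) \<le> 4 * ?I powr (1 / r)"
  proof (rule norm_positive_op_le[OF positive_op_add[OF P Q]])
    fix x :: 'a assume x: "norm x = 1"
    have nonneg: "0 \<le> rinner ((P + Q) x) x"
      using positive_op_add[OF P Q] by (simp add: positive_op_def)
    have "((rinner ((P + Q) x) x / 4) powr r) powr (1 / r) \<le> ?I powr (1 / r)"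
      by (rule powr_mono2[OF _ _ integral_op_powr_half_segment_ge[OF P Q r x]]) (use r in auto)
    then show "rinner ((P + Q) x) x \<le> 4 * ?I powr (1 / r)"
      using nonneg r by (simp add: powr_powr)
  qed simp
  then have "(norm (P + Q) / 4) powr r \<le> (?I powr (1 / r)) powr r"
    using r by (intro powr_mono2) auto
  then show ?thesis using r by (simp add: powr_powr)
qed

theorem corollary2p1:
  fixes A :: "'a::complex_hilbert_space \<Rightarrow>\<^sub>L 'a"
  assumes "A \<in> bounded_ops"
  shows "(\<forall>r::real. 1 \<le> r \<and> r \<le> 2 \<longrightarrow>
      1 / 4 powr r * norm (abs_op A + abs_op (adjoint_op A)) powr r
        \<le> norm (integral {0..1} (\<lambda>t::real.
            op_powr (((1 - t) *\<^sub>R abs_op A + t *\<^sub>R abs_op (adjoint_op A)) /\<^sub>R 2) r)) \<and>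
      norm (integral {0..1} (\<lambda>t::real.
            op_powr (((1 - t) *\<^sub>R abs_op A + t *\<^sub>R abs_op (adjoint_op A)) /\<^sub>R 2) r))
        \<le> 1 / 2 powr r * norm A powr r) \<and>
    1 / 4 * norm (abs_op A + abs_op (adjoint_op A))
      \<le> norm (integral {0..1} (\<lambda>t::real.
          op_powr (((1 - t) *\<^sub>R abs_op A + t *\<^sub>R abs_op (adjoint_op A)) /\<^sub>R 2) 2)) powr (1/2) \<and>
    norm (integral {0..1} (\<lambda>t::real.
          op_powr (((1 - t) *\<^sub>R abs_op A + t *\<^sub>R abs_op (adjoint_op A)) /\<^sub>R 2) 2)) powr (1/2)
      \<le> 1 / 2 * norm A"
proof -
  define P where "P = abs_op A"
  define Q where "Q = abs_op (adjoint_op A)"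
  define I where "I r = norm (integral {0..1} (\<lambda>t. op_powr (half_segment P Q t) r))" for r
  have adj: "adjoint_op A \<in> bounded_ops" by (rule adjoint_op(1)[OF assms])
  have pos: "positive_op P" "positive_op Q"
    unfolding P_def Q_def by (intro positive_abs_op assms adj)+
  have norms: "norm P \<le> norm A" "norm Q \<le> norm A"
    unfolding P_def Q_def
    using norm_abs_op_le[OF assms] norm_abs_op_le[OF adj] norm_adjoint_op_le[OF assms] by auto
  have lower: "(norm (P + Q) / 4) powr r \<le> I r" if "1 \<le> r" for r
    unfolding I_def by (rule norm_powr_le_norm_integral_op_powr_half_segment[OF pos that])
  have upper: "I r \<le> (norm A / 2) powr r" if "1 \<le> r" for r
    unfolding I_def using that
    by (intro norm_integral_op_powr_half_segment_le[OF pos norms]) simp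
  have root: "(s powr 2) powr (1/2) = s" if "0 \<le> s" for s :: real
    using that by (simp add: powr_powr)
  have "norm (P + Q) / 4 \<le> I 2 powr (1/2)"
    using powr_mono2[OF _ _ lower[of 2], of "1/2"] by (simp add: root)
  moreover have "I 2 powr (1/2) \<le> norm A / 2"
    using powr_mono2[OF _ _ upper[of 2], of "1/2"] by (simp add: root I_def)
  moreover have "1 / 4 powr r * norm (P + Q) powr r \<le> I r \<and> I r \<le> 1 / 2 powr r * norm A powr r"
    if "1 \<le> r" for r
    using lower[OF that] upper[OF that] by (simp add: powr_divide)
  ultimately show ?thesis
    by (simp add: I_def P_def Q_def half_segment_def)
qed

end
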